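(* Let $W$ and $R$ be positive integers and $\epsilon>0$. Set $\upsilon=\lceil\log(\epsilon^{-1}W)\rceil$ and $k=\left\lceil\frac{1}{2\epsilon-2^{-\upsilon}}\right\rceil$. Then Algorithm 3 (described in the context, run with these parameters) provides an $RW\epsilon$-additive approximation for Basic-Summing; that is, for every input stream of integers in $\{0,1,\dots,R\}$ and at every time, the value $\widehat S$ returned by Query satisfies $|\widehat S-S|\le RW\epsilon$.
   Context: All logarithms are base 2. Basic-Summing: given a stream of integers in $\{0,1,\dots,R\}$ arriving one at a time, maintain the sum $S$ of the last $W$ elements (elements before the beginning of the stream are regarded as 0). For $z\in[0,1]$, $\mathrm{Round}_{\upsilon}(z)$ denotes rounding of $z$ to the nearest value $\widetilde z$ such that $2^{\upsilon}\widetilde z$ is an integer. Algorithm 3 (intended for small $\epsilon$). Variables: a fractional number $y$, integers $B,i$, and an array $b=(b_0,\dots,b_{W-1})$ of nonnegative integers, all initialized to $0$. Add(element $x$): do in order: (1) $x'=\mathrm{Round}_{\upsilon}\left(\frac xR\right)$; (2) $B\leftarrow B-b_i$; (3) $b_i\leftarrow\left\lfloor\frac{y+x'}{W/k}\right\rfloor$; (4) $y\leftarrow y+x'-b_i\cdot\frac Wk$; (5) $B\leftarrow B+b_i$; (6) $i\leftarrow i+1\bmod W$. Query: return $R\cdot\left(\frac Wk\cdot B+y-\frac W{2k}\right)$. Each arriving stream element is processed by one call of Add. *)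

theory Defs
  imports Complex_Main
begin

text \<open>
  \<open>rounds_to_grid v rnd\<close> says that \<open>rnd\<close> is a rounding function on the unit interval: each \<open>z\<close> is
  sent to a nearest point of the grid of all \<open>w\<close> such that \<open>2\<^sup>v w\<close> is an integer. How ties are
  broken is left open. The exponent \<open>v\<close> may be negative, and the grid is not restricted to the
  unit interval.
\<close>

definition rounds_to_grid :: "int \<Rightarrow> (real \<Rightarrow> real) \<Rightarrow> bool" where
  "rounds_to_grid v rnd \<longleftrightarrow>
     (\<forall>z\<in>{0..1}. is_arg_min (\<lambda>w. \<bar>w - z\<bar>) (\<lambda>w. 2 powi v * w \<in> \<int>) (rnd z))"

text \<open>Rounding half up, for instance, is such a function.\<close>

lemma rounds_to_grid_round:
  "rounds_to_grid v (\<lambda>z. of_int (round (2 powi v * z)) / 2 powi v)"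
proof -
  have "\<bar>of_int (round (2 powi v * z)) / 2 powi v - z\<bar> \<le> \<bar>w - z\<bar>"
    if grid: "2 powi v * w \<in> \<int>" for w z :: real
  proof -
    define p :: real where "p = 2 powi v"
    have p: "p > 0" by (simp add: p_def)
    obtain m where m: "p * w = of_int m"
      using grid unfolding p_def by (rule Ints_cases)
    have "\<bar>p * z - of_int (round (p * z))\<bar> \<le> \<bar>p * z - of_int m\<bar>"
      by (rule round_diff_minimal)
    then have "\<bar>p * (of_int (round (p * z)) / p - z)\<bar> \<le> \<bar>p * (w - z)\<bar>"
      using p m by (simp add: right_diff_distrib abs_minus_commute)
    then show ?thesis
      using p by (simp add: abs_mult p_def)
  qed
  then show ?thesis
    by (auto simp: rounds_to_grid_def is_arg_min_def not_less)
qed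

text \<open>
  The entries of the array are typed as integers, so that none of the assignments below involves
  truncated arithmetic; that they are nonnegative is an invariant and not part of the type.
\<close>

record alg_state =
  st_y :: real
  st_B :: int
  st_i :: nat
  st_b :: "int list"

definition alg_init :: "nat \<Rightarrow> alg_state" where
  "alg_init W = \<lparr>st_y = 0, st_B = 0, st_i = 0, st_b = replicate W 0\<rparr>"

definition alg_add ::
  "nat \<Rightarrow> nat \<Rightarrow> int \<Rightarrow> (real \<Rightarrow> real) \<Rightarrow> nat \<Rightarrow> alg_state \<Rightarrow> alg_state" where
  "alg_add W R k rnd x s =
     (let x' = rnd (real x / real R);
          B1 = st_B s - st_b s ! st_i s;
          bi = \<lfloor>(st_y s + x') / (real W / of_int k)\<rfloor>;
          y' = st_y s + x' - of_int bi * (real W / of_int k);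
          B2 = B1 + bi;
          i' = (st_i s + 1) mod W
      in \<lparr>st_y = y', st_B = B2, st_i = i', st_b = (st_b s)[st_i s := bi]\<rparr>)"

definition alg_query :: "nat \<Rightarrow> nat \<Rightarrow> int \<Rightarrow> alg_state \<Rightarrow> real" where
  "alg_query W R k s =
     real R * (real W / of_int k * of_int (st_B s) + st_y s - real W / (2 * of_int k))"

text \<open>The stream is \<open>x 0, x 1, \<dots>\<close>, and time \<open>t\<close> is the moment after \<open>x 0, \<dots>, x (t - 1)\<close> have arrived.\<close>

primrec alg_run ::
  "nat \<Rightarrow> nat \<Rightarrow> int \<Rightarrow> (real \<Rightarrow> real) \<Rightarrow> (nat \<Rightarrow> nat) \<Rightarrow> nat \<Rightarrow> alg_state" where
  "alg_run W R k rnd x 0 = alg_init W"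
| "alg_run W R k rnd x (Suc t) = alg_add W R k rnd (x t) (alg_run W R k rnd x t)"

text \<open>
  The subtraction is truncated, so for \<open>t < W\<close> only the \<open>t\<close> elements seen so far are summed; this
  counts the elements before the beginning of the stream as \<open>0\<close>.
\<close>

definition window_sum :: "nat \<Rightarrow> (nat \<Rightarrow> nat) \<Rightarrow> nat \<Rightarrow> nat" where
  "window_sum W x t = (\<Sum>j\<in>{t - W..<t}. x j)"

end

theory Submission
  imports Defs
begin

text \<open>
  Put \<open>c = W / k\<close>. The remainder \<open>y\<close> always lies in \<open>[0, c]\<close>, and each step satisfies
  \<open>c * b\<^sub>j = x'\<^sub>j + y\<^sub>j - y\<^sub>j\<^sub>+\<^sub>1\<close>. Since \<open>B\<close> is the sum of the last \<open>W\<close> block values, telescoping shows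
  that the query differs from \<open>R\<close> times the sum of the rounded window only by
  \<open>R * (y - c / 2)\<close>, where \<open>y\<close> is the remainder at the left end of the window. This contributes
  at most \<open>R * W / (2 * k)\<close>, and rounding at most \<open>R * W * 2 powi (- \<upsilon>) / 2\<close>. The parameter \<open>k\<close> is chosen
  so that the two add up to at most \<open>R * W * \<epsilon>\<close>.
\<close>

text \<open>Minimality lets \<open>rnd z\<close> be compared with any grid point. Rounding
  \<open>p * z\<close> to an integer yields one within half the grid spacing, however
  \<open>rnd\<close> breaks ties.\<close>

lemma rounds_to_grid_error:
  assumes "rounds_to_grid v rnd" "z \<in> {0..1}"
  shows "\<bar>rnd z - z\<bar> \<le> 2 powi (- v) / 2"
proof -
  define p :: real where "p = 2 powi v"
  have p: "p > 0" by (simp add: p_def)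
  define w where "w = of_int (round (p * z)) / p"
  have "2 powi v * w \<in> \<int>" using p by (simp add: w_def flip: p_def)
  then have "\<bar>rnd z - z\<bar> \<le> \<bar>w - z\<bar>"
    using assms by (auto simp: rounds_to_grid_def is_arg_min_def not_less)
  also have "w - z = (of_int (round (p * z)) - p * z) / p"
    using p by (simp add: w_def field_simps)
  also have "\<bar>\<dots>\<bar> \<le> (1 / 2) / p"
    using p of_int_round_abs_le[of "p * z"] by (simp add: abs_divide field_simps)
  also have "\<dots> = 2 powi (- v) / 2"
    by (simp add: p_def power_int_minus field_simps)
  finally show ?thesis .
qed

lemma sum_window_Suc:
  fixes f :: "nat \<Rightarrow> 'a::ab_group_add"
  assumes "W > 0"
  shows "sum f {Suc t - W..<Suc t} = sum f {t - W..<t} - (if t < W then 0 else f (t - W)) + f t"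
\<comment> \<open>While \<open>t < W\<close>, truncation keeps both left ends at 0 and nothing
  leaves the window.\<close>
proof (cases "t < W")
  case True
  then show ?thesis by (simp add: Suc_diff_le)
next
  case False
  then have "sum f {t - W..<t} = f (t - W) + sum f {Suc t - W..<t}"
    using assms by (simp add: sum.atLeast_Suc_lessThan Suc_diff_le)
  moreover have "sum f {Suc t - W..<Suc t} = sum f {Suc t - W..<t} + f t"
    using assms by (intro sum.atLeastLessThan_Suc) simp
  ultimately show ?thesis using False by simp
qed

text \<open>Indexing the stored values by time rather than by array position makes the buffer and
  \<open>st_B\<close> expressible in closed form.\<close>

definition block ::
  "nat \<Rightarrow> nat \<Rightarrow> int \<Rightarrow> (real \<Rightarrow> real) \<Rightarrow> (nat \<Rightarrow> nat) \<Rightarrow> nat \<Rightarrow> int" where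
  "block W R k rnd x t =
     \<lfloor>(st_y (alg_run W R k rnd x t) + rnd (real (x t) / real R)) / (real W / of_int k)\<rfloor>"

lemma st_y_run_Suc:
  "st_y (alg_run W R k rnd x (Suc t)) =
     st_y (alg_run W R k rnd x t) + rnd (real (x t) / real R)
       - of_int (block W R k rnd x t) * (real W / of_int k)"
  by (simp add: alg_add_def block_def Let_def)

text \<open>Each step replaces \<open>u\<close> by its remainder modulo \<open>c\<close>, whatever
  the sign of \<open>u\<close>. The closed right end suffices, because only the distance from
  \<open>c / 2\<close> is used later.\<close>

lemma st_y_run_bounds:
  assumes "W > 0" "k > 0"
  shows "st_y (alg_run W R k rnd x t) \<in> {0..real W / of_int k}"
proof (cases t)
  case 0
  then show ?thesis using assms by (simp add: alg_init_def)
next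
  case (Suc n)
  define c where "c = real W / of_int k"
  define u where "u = st_y (alg_run W R k rnd x n) + rnd (real (x n) / real R)"
  have c: "c > 0" using assms by (simp add: c_def)
  have "st_y (alg_run W R k rnd x t) = u - of_int \<lfloor>u / c\<rfloor> * c"
    unfolding Suc st_y_run_Suc by (simp add: block_def c_def u_def)
  moreover have "of_int \<lfloor>u / c\<rfloor> * c \<le> u"
    using c of_int_floor_le[of "u / c"] by (simp only: pos_le_divide_eq)
  moreover have "u \<le> (of_int \<lfloor>u / c\<rfloor> + 1) * c"
    using c real_of_int_floor_add_one_ge[of "u / c"] by (simp only: pos_divide_le_eq)
  ultimately show ?thesis by (simp add: c_def[symmetric] algebra_simps)
qed

text \<open>The clauses are proved together: the update of \<open>st_B\<close> is correct only if
  the overwritten slot holds exactly the value leaving the window, which the two clauses on array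
  entries supply.\<close>

lemma run_ring_buffer:
  fixes W R :: nat and k :: int and rnd :: "real \<Rightarrow> real" and x :: "nat \<Rightarrow> nat"
  assumes "W > 0"
  defines "s \<equiv> alg_run W R k rnd x" and "\<beta> \<equiv> block W R k rnd x"
  shows "st_i (s t) = t mod W" "length (st_b (s t)) = W"
    "\<And>j. j < t \<Longrightarrow> t \<le> j + W \<Longrightarrow> st_b (s t) ! (j mod W) = \<beta> j"
    "\<And>j. t \<le> j \<Longrightarrow> j < W \<Longrightarrow> st_b (s t) ! j = 0"
    "st_B (s t) = sum \<beta> {t - W..<t}"
proof (induction t)
  case 0
  { case 1 show ?case by (simp add: s_def alg_init_def) }
  { case 2 show ?case by (simp add: s_def alg_init_def) }
  { case 3 then show ?case by simp }
  { case 4 then show ?case by (simp add: s_def alg_init_def) }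
  { case 5 show ?case by (simp add: s_def alg_init_def) }
next
  case (Suc t)
  have i: "st_i (s (Suc t)) = Suc (st_i (s t)) mod W"
    and b: "st_b (s (Suc t)) = (st_b (s t))[st_i (s t) := \<beta> t]"
    and B: "st_B (s (Suc t)) = st_B (s t) - st_b (s t) ! st_i (s t) + \<beta> t"
    by (simp_all add: s_def \<beta>_def alg_add_def block_def Let_def)
  { case 1 show ?case by (simp add: i Suc.IH(1) mod_Suc_eq) }
  { case 2 show ?case by (simp add: b Suc.IH(2)) }
  { case (3 j)
    show ?case
    proof (cases "j = t")
      case True
      then show ?thesis using assms(1) by (simp add: b Suc.IH(1,2))
    next
      case False
      \<comment> \<open>Here \<open>0 < t - j < W\<close>, so writing at time \<open>t\<close>
        spares the slot of \<open>j\<close>.\<close>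
      have "t mod W \<noteq> j mod W"
      proof
        assume "t mod W = j mod W"
        then have "W dvd t - j" using 3 by (simp add: mod_eq_dvd_iff_nat)
        then show False using 3 False by (auto dest: dvd_imp_le)
      qed
      then show ?thesis using 3 False by (simp add: b Suc.IH(1,3))
    qed }
  { case (4 j) then show ?case by (simp add: b Suc.IH(1,4)) }
  { case 5
    \<comment> \<open>The slot about to be overwritten holds the oldest retained value, the boundary
      case \<open>t = j + W\<close>, or still its initial 0 during the first \<open>W\<close>
      steps.\<close>
    have "st_b (s t) ! (t mod W) = (if t < W then 0 else \<beta> (t - W))"
      using Suc.IH(3)[of "t - W"] Suc.IH(4)[of t] assms(1) by (auto simp: le_mod_geq)
    then show ?case
      by (simp only: B Suc.IH(1,5) sum_window_Suc[OF assms(1)]) }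
qed

lemma run_query_eq:
  fixes x :: "nat \<Rightarrow> nat"
  assumes "W > 0" "k > 0"
  shows "alg_query W R k (alg_run W R k rnd x t) =
    real R * ((\<Sum>j\<in>{t - W..<t}. rnd (real (x j) / real R))
      + (st_y (alg_run W R k rnd x (t - W)) - real W / (2 * of_int k)))"
proof -
  let ?y = "\<lambda>t. st_y (alg_run W R k rnd x t)" and ?c = "real W / of_int k"
  let ?r = "\<lambda>j. rnd (real (x j) / real R)"
  have "?c * of_int (st_B (alg_run W R k rnd x t))
      = (\<Sum>j\<in>{t - W..<t}. of_int (block W R k rnd x j) * ?c)"
    using assms(1) by (simp add: run_ring_buffer(5) sum_distrib_left mult.commute)
  also have "\<dots> = (\<Sum>j\<in>{t - W..<t}. ?r j - (?y (Suc j) - ?y j))"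
    by (simp only: st_y_run_Suc) simp
  \<comment> \<open>The term \<open>?y t\<close> cancels against the \<open>st_y\<close> that the
    query adds.\<close>
  also have "\<dots> = sum ?r {t - W..<t} - (?y t - ?y (t - W))"
    by (subst sum_subtractf, subst sum_Suc_diff') auto
  finally show ?thesis by (simp add: alg_query_def)
qed

lemma run_query_error:
  fixes x :: "nat \<Rightarrow> nat"
  assumes "W > 0" "R > 0" "k > 0" "rounds_to_grid v rnd" "\<And>n. x n \<le> R"
  shows "\<bar>alg_query W R k (alg_run W R k rnd x t) - real (window_sum W x t)\<bar>
    \<le> real R * real W * (2 powi (- v) / 2 + 1 / (2 * of_int k))"
proof -
  let ?I = "{t - W..<t}" and ?r = "\<lambda>j. rnd (real (x j) / real R)"
  let ?e = "st_y (alg_run W R k rnd x (t - W)) - real W / (2 * of_int k)"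
  have "real (window_sum W x t) = real R * (\<Sum>j\<in>?I. real (x j) / real R)"
    using assms(2) by (simp add: window_sum_def sum_distrib_left)
  then have "alg_query W R k (alg_run W R k rnd x t) - real (window_sum W x t)
      = real R * ((\<Sum>j\<in>?I. ?r j - real (x j) / real R) + ?e)"
    unfolding run_query_eq[OF assms(1,3)] by (simp add: sum_subtractf algebra_simps)
  then have "\<bar>alg_query W R k (alg_run W R k rnd x t) - real (window_sum W x t)\<bar>
      = real R * \<bar>(\<Sum>j\<in>?I. ?r j - real (x j) / real R) + ?e\<bar>"
    by (simp add: abs_mult)
  also have "\<dots> \<le> real R * (real W * (2 powi (- v) / 2) + real W / (2 * of_int k))"
  proof (intro mult_left_mono order.trans[OF abs_triangle_ineq] add_mono)
    have "\<bar>\<Sum>j\<in>?I. ?r j - real (x j) / real R\<bar> \<le> (\<Sum>j\<in>?I. \<bar>?r j - real (x j) / real R\<bar>)"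
      by (rule sum_abs)
    also have "\<dots> \<le> real (card ?I) * (2 powi (- v) / 2)"
      using assms by (intro sum_bounded_above rounds_to_grid_error) auto
    also have "\<dots> \<le> real W * (2 powi (- v) / 2)"
      by (intro mult_right_mono) auto
    finally show "\<bar>\<Sum>j\<in>?I. ?r j - real (x j) / real R\<bar> \<le> real W * (2 powi (- v) / 2)" .
    \<comment> \<open>The query's offset is the midpoint of the range of the remainder, which halves
      the worst-case error.\<close>
    have "real W / of_int k = 2 * (real W / (2 * of_int k))" by simp
    then show "\<bar>?e\<bar> \<le> real W / (2 * of_int k)"
      using st_y_run_bounds[OF assms(1,3), of R rnd x "t - W"]
      unfolding atLeastAtMost_iff by linarith
  qed simp
  finally show ?thesis by (simp add: algebra_simps)
qed

theorem theorem17: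
  fixes W R :: nat and \<epsilon> :: real and \<upsilon> k :: int and rnd :: "real \<Rightarrow> real"
  assumes "W > 0" and "R > 0" and "\<epsilon> > 0"
    and "\<upsilon> = \<lceil>log 2 (inverse \<epsilon> * real W)\<rceil>"
    and "k = \<lceil>1 / (2 * \<epsilon> - 2 powi (- \<upsilon>))\<rceil>"
    and "rounds_to_grid \<upsilon> rnd"
  shows "\<forall>x :: nat \<Rightarrow> nat. (\<forall>n. x n \<in> {0..R}) \<longrightarrow>
           (\<forall>t. \<bar>alg_query W R k (alg_run W R k rnd x t) - real (window_sum W x t)\<bar>
                  \<le> real R * real W * \<epsilon>)"
proof -
  define q :: real where "q = 2 powi (- \<upsilon>)"
  have pos: "inverse \<epsilon> * real W > 0" using assms by simp
  have "log 2 (inverse \<epsilon> * real W) \<le> of_int \<upsilon>"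
    unfolding assms(4) by (rule le_of_int_ceiling)
  then have "inverse \<epsilon> * real W \<le> 2 powi \<upsilon>"
    using pos by (simp add: log_le_iff powr_real_of_int')
  \<comment> \<open>As \<open>W\<close> is at least 1, this leads to
    \<open>q \<le> \<epsilon>\<close>, so the denominator defining \<open>k\<close> is positive and
    hence so is \<open>k\<close>.\<close>
  moreover have "inverse \<epsilon> \<le> inverse \<epsilon> * real W"
    using assms by simp
  ultimately have "inverse \<epsilon> \<le> 2 powi \<upsilon>"
    by linarith
  then have "inverse (2 powi \<upsilon>) \<le> inverse (inverse \<epsilon>)"
    using assms(3) by (intro le_imp_inverse_le) auto
  then have "q \<le> \<epsilon>" by (simp add: q_def power_int_minus)
  then have d: "2 * \<epsilon> - q > 0" using assms(3) by simp
  have k_ge: "1 / (2 * \<epsilon> - q) \<le> of_int k"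
    unfolding assms(5) q_def by (rule le_of_int_ceiling)
  moreover have "1 / (2 * \<epsilon> - q) > 0" using d by simp
  ultimately have k: "k > 0" by linarith
  \<comment> \<open>Halving this leaves for the remainder exactly the part of
    \<open>\<epsilon>\<close> not spent on rounding.\<close>
  have "1 / of_int k \<le> 2 * \<epsilon> - q"
    using k_ge d k by (simp add: field_simps)
  then have "q / 2 + 1 / (2 * of_int k) \<le> \<epsilon>" by simp
  then have "real R * real W * (q / 2 + 1 / (2 * of_int k)) \<le> real R * real W * \<epsilon>"
    by (intro mult_left_mono) auto
  with run_query_error[OF assms(1,2) k assms(6)] show ?thesis
    unfolding q_def by (meson atLeastAtMost_iff order_trans)
qed

end
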